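(* Let $u,v\in\mathbb{R}(x,y)$ be rational functions satisfying the system $$\begin{cases}(xu_{xx}+yu_{xy})(vu_y-uv_y)+(yu_{yy}+xu_{xy})(uv_x-vu_x)=2(u-xu_x-yu_y)(u_xv_y-u_yv_x),\\ (xv_{xx}+yv_{xy})(vu_y-uv_y)+(yv_{yy}+xv_{xy})(uv_x-vu_x)=2(v-xv_x-yv_y)(u_xv_y-u_yv_x),\end{cases}$$ together with the boundary condition $$\lim_{z\to0}\frac{u(xz,yz)}{z}=x,\qquad \lim_{z\to0}\frac{v(xz,yz)}{z}=y.$$ Then $(x,y)\mapsto(u(x,y),v(x,y))$ is a birational transformation of the plane.
   Context: Subscripts denote partial derivatives. The limits are understood as identities of rational functions in $x,y$ (i.e. for generic $(x,y)$). A birational transformation of the plane is a pair of rational functions possessing a two-sided compositional inverse which is also a pair of rational functions. *)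

theory Defs
  imports Complex_Main "HOL-Computational_Algebra.Computational_Algebra"
    "HOL-Computational_Algebra.Field_as_Ring"
begin

(* The inner variable of "real poly poly" is x, the outer one is y. *)
type_synonym ratfun = "real poly poly fract"

definition ratfun_X :: ratfun where
  "ratfun_X = to_fract [:[:0, 1:]:]"

definition ratfun_Y :: ratfun where
  "ratfun_Y = to_fract [:0, 1:]"

definition ratfun_const :: "real \<Rightarrow> ratfun" where
  "ratfun_const c = to_fract [:[:c:]:]"

(* Extends a derivation D of an integral domain to its fraction field by the quotient rule. *)
definition fract_deriv ::
    "('a \<Rightarrow> 'a) \<Rightarrow> 'a::{idom_divide,ring_gcd,semiring_gcd_mult_normalize} fract \<Rightarrow> 'a fract" where
  "fract_deriv D f = (let (p, q) = quot_of_fract f in Fract (D p * q - p * D q) (q ^ 2))"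

definition dx :: "ratfun \<Rightarrow> ratfun" where
  "dx = fract_deriv (map_poly pderiv)"

definition dy :: "ratfun \<Rightarrow> ratfun" where
  "dy = fract_deriv pderiv"

(* Value at (x, y) = (a, b) in a ring K, where h embeds the scalars into K. *)
definition bipoly_eval ::
    "(real \<Rightarrow> 'k::comm_ring_1) \<Rightarrow> real poly poly \<Rightarrow> 'k \<Rightarrow> 'k \<Rightarrow> 'k" where
  "bipoly_eval h p a b = poly (map_poly (\<lambda>c. poly (map_poly h c) a) p) b"

(* quot_of_fract yields a representation in lowest terms, so a rational function is defined
   at (a, b) for some representation as a quotient iff this holds. *)
definition ratfun_defined_at ::
    "(real \<Rightarrow> 'k::field) \<Rightarrow> ratfun \<Rightarrow> 'k \<Rightarrow> 'k \<Rightarrow> bool" where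
  "ratfun_defined_at h f a b \<longleftrightarrow> bipoly_eval h (snd (quot_of_fract f)) a b \<noteq> 0"

(* Meaningful where the denominator does not vanish; 0 by convention elsewhere. *)
definition ratfun_eval ::
    "(real \<Rightarrow> 'k::field) \<Rightarrow> ratfun \<Rightarrow> 'k \<Rightarrow> 'k \<Rightarrow> 'k" where
  "ratfun_eval h f a b =
     bipoly_eval h (fst (quot_of_fract f)) a b / bipoly_eval h (snd (quot_of_fract f)) a b"

(* f(g1, g2) is a well-defined rational function and equals k. *)
definition ratfun_comp_eq :: "ratfun \<Rightarrow> ratfun \<Rightarrow> ratfun \<Rightarrow> ratfun \<Rightarrow> bool" where
  "ratfun_comp_eq f g1 g2 k \<longleftrightarrow>
     ratfun_defined_at ratfun_const f g1 g2 \<and> ratfun_eval ratfun_const f g1 g2 = k"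

definition birational_plane :: "ratfun \<Rightarrow> ratfun \<Rightarrow> bool" where
  "birational_plane u v \<longleftrightarrow>
     (\<exists>s t. ratfun_comp_eq u s t ratfun_X \<and> ratfun_comp_eq v s t ratfun_Y \<and>
            ratfun_comp_eq s u v ratfun_X \<and> ratfun_comp_eq t u v ratfun_Y)"

(* P holds on a nonempty Zariski-open subset of the real plane. *)
definition generically :: "(real \<Rightarrow> real \<Rightarrow> bool) \<Rightarrow> bool" where
  "generically P \<longleftrightarrow> (\<exists>g. g \<noteq> 0 \<and> (\<forall>a b. bipoly_eval id g a b \<noteq> 0 \<longrightarrow> P a b))"

(* The quotient rule does not depend on the representation. *)

lemma fract_deriv_Fract:
  fixes D :: "'a \<Rightarrow> 'a::{idom_divide,ring_gcd,semiring_gcd_mult_normalize}"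
  assumes D: "\<And>p q. D (p * q) = D p * q + p * D q" and q: "q \<noteq> 0"
  shows "fract_deriv D (Fract p q) = Fract (D p * q - p * D q) (q ^ 2)"
proof -
  obtain r s where rs: "quot_of_fract (Fract p q) = (r, s)" by fastforce
  have s: "s \<noteq> 0" using snd_quot_of_fract_nonzero[of "Fract p q"] rs by simp
  have "Fract r s = Fract p q" using Fract_quot_of_fract[of "Fract p q"] rs by simp
  hence e: "r * q = p * s" using q s by (simp add: eq_fract)
  have e': "D r * q + r * D q = D p * s + p * D s" using D[of r q] D[of p s] e by simp
  have "(D r * s - r * D s) * q ^ 2 - (D p * q - p * D q) * s ^ 2
      = q * s * (D r * q + r * D q - (D p * s + p * D s))
        - (r * q - p * s) * (q * D s + s * D q)"
    by (simp add: algebra_simps power2_eq_square)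
  also have "\<dots> = 0" using e e' by simp
  finally have "(D r * s - r * D s) * q ^ 2 = (D p * q - p * D q) * s ^ 2" by simp
  thus ?thesis using q s by (simp add: fract_deriv_def rs eq_fract)
qed

lemma map_poly_pderiv_mult:
  fixes p q :: "real poly poly"
  shows "map_poly pderiv (p * q) = map_poly pderiv p * q + p * map_poly pderiv q"
proof (rule poly_eqI)
  fix n
  have "pderiv (\<Sum>i\<le>n. coeff p i * coeff q (n - i))
      = (\<Sum>i\<le>n. pderiv (coeff p i * coeff q (n - i)))"
    using higher_pderiv_sum[of 1] by simp
  also have "\<dots> = (\<Sum>i\<le>n. pderiv (coeff p i) * coeff q (n - i))
      + (\<Sum>i\<le>n. coeff p i * pderiv (coeff q (n - i)))"
    by (simp add: pderiv_mult sum.distrib algebra_simps)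
  finally show "coeff (map_poly pderiv (p * q)) n
      = coeff (map_poly pderiv p * q + p * map_poly pderiv q) n"
    by (simp add: coeff_map_poly coeff_mult)
qed

lemma dx_Fract:
  assumes "q \<noteq> 0"
  shows "dx (Fract p q) = Fract (map_poly pderiv p * q - p * map_poly pderiv q) (q ^ 2)"
  unfolding dx_def using map_poly_pderiv_mult assms by (rule fract_deriv_Fract)

lemma dy_Fract:
  assumes "q \<noteq> 0"
  shows "dy (Fract p q) = Fract (pderiv p * q - p * pderiv q) (q ^ 2)"
  unfolding dy_def using assms by (intro fract_deriv_Fract) (simp_all add: pderiv_mult algebra_simps)

end

theory Submission
  imports Defs
begin

text \<open>
  The two differential equations say that \<open>(u, v)\<close> is the time-one map of the flow of a vector
  field that is homogeneous of degree 2, and the inverse of such a map is the map at time -1.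

  Write \<open>E = x d/dx + y d/dy\<close> for the Euler derivation and \<open>J\<close> for the Jacobian determinant of
  \<open>(u, v)\<close>, which is 1 at the origin by the boundary condition. Let \<open>W = P d/dx + Q d/dy\<close> be the
  vector field determined by \<open>(E - W) u = u\<close> and \<open>(E - W) v = v\<close>, so that
  \<open>P = x + (v u\<^sub>y - u v\<^sub>y) / J\<close> and \<open>Q = y + (u v\<^sub>x - v u\<^sub>x) / J\<close>. Applying \<open>E\<close> to these two
  first-order equations shows that the given system is equivalent to \<open>E P = 2 P\<close>, \<open>E Q = 2 Q\<close>,
  that is, to the homogeneity of \<open>P\<close> and \<open>Q\<close>.

  The usual flow is \<open>F\<^sup>t(x, y) = (u(tx, ty), v(tx, ty)) / t\<close>. Homogeneity allows the time
  parameter to be dropped: every identity about \<open>F\<^sup>t\<close> is an identity between rational functions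
  in which \<open>E\<close> replaces \<open>t d/dt\<close>. Two such identities are needed.

  \<^item> \<open>W u = P(u, v)\<close> and \<open>W v = Q(u, v)\<close> (the flow satisfies the autonomous equation).
    The difference \<open>g\<close> of the two sides satisfies \<open>(E - W) g = 2 g\<close>.

  \<^item> \<open>u(-u, -v) = -x\<close> and \<open>v(-u, -v) = -y\<close> (time -1 undoes time 1). By the first
    identity and the chain rule, the left-hand sides are eigenfunctions of \<open>E\<close> with eigenvalue 1.

  Both follow from one uniqueness principle: \<open>W\<close> raises the order of vanishing at the origin and
  \<open>E\<close> multiplies the leading form by its degree, so a solution of \<open>(E - W) g = k g\<close> vanishes as soon
  as it has no part of degree at most \<open>k\<close>. This is \<open>transport_uniqueness\<close>.
  The order of a rational function and its leading form are read off from the Laurent series of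
  \<open>f(tx, ty)\<close> in \<open>t\<close>, with coefficients in the field of rational functions; \<open>leads_ratfun_eval\<close>
  says that the substitution of \<open>(u, v)\<close> for \<open>(x, y)\<close> does not change them, and that
  \<open>(-u, -v)\<close> changes the leading form only by the sign of its degree.

  The second identity exhibits the inverse \<open>(-u(-x, -y), -v(-x, -y))\<close> on one side; the other side
  is the same identity after the automorphism \<open>(x, y) \<mapsto> (-x, -y)\<close>.
\<close>

unbundle fps_syntax

section \<open>Evaluation of bivariate polynomials\<close>

locale unital_ring_hom =
  fixes h :: "'a::comm_ring_1 \<Rightarrow> 'b::comm_ring_1"
  assumes hom_add: "h (x + y) = h x + h y"
    and hom_mult: "h (x * y) = h x * h y"
    and hom_one: "h 1 = 1"
begin

lemma hom_zero: "h 0 = 0"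
  using hom_add[of 0 0] by simp

lemma hom_uminus: "h (- x) = - h x"
  using hom_add[of x "- x"] hom_zero by (simp add: eq_neg_iff_add_eq_0 add.commute)

lemma hom_diff: "h (x - y) = h x - h y"
  using hom_add[of x "- y"] by (simp add: hom_uminus)

lemma hom_power: "h (x ^ n) = h x ^ n"
  by (induction n) (simp_all add: hom_one hom_mult)

lemmas hom_simps = hom_add hom_mult hom_one hom_zero hom_uminus hom_diff hom_power

lemma map_poly_add: "map_poly h (p + q) = map_poly h p + map_poly h q"
  by (rule poly_eqI) (simp add: coeff_map_poly hom_simps)

lemma map_poly_smult: "map_poly h (smult c p) = smult (h c) (map_poly h p)"
  by (rule poly_eqI) (simp add: coeff_map_poly hom_simps)

lemma poly_map_hom: "unital_ring_hom (\<lambda>p. poly (map_poly h p) a)"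
proof
  show add: "poly (map_poly h (p + q)) a = poly (map_poly h p) a + poly (map_poly h q) a" for p q
    by (simp add: map_poly_add)
  show "poly (map_poly h (p * q)) a = poly (map_poly h p) a * poly (map_poly h q) a" for p q
    by (induction p)
      (simp_all add: add map_poly_pCons map_poly_smult hom_zero algebra_simps)
  show "poly (map_poly h 1) a = 1"
    by (simp add: hom_one)
qed


end

lemma bipoly_eval_hom:
  assumes "unital_ring_hom h"
  shows "unital_ring_hom (\<lambda>p. bipoly_eval h p a b)"
  unfolding bipoly_eval_def
  by (intro unital_ring_hom.poly_map_hom assms)

lemma bipoly_eval_generators:
  assumes "unital_ring_hom h"
  shows "bipoly_eval h [:[:c:]:] a b = h c"
    and "bipoly_eval h [:[:0, 1:]:] a b = a"
    and "bipoly_eval h [:0, 1:] a b = b"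
  using unital_ring_hom.hom_zero[OF assms] unital_ring_hom.hom_one[OF assms]
  by (simp_all add: bipoly_eval_def map_poly_pCons)

lemma bipoly_induct [case_names const X Y add mult]:
  fixes p :: "'a::comm_ring_1 poly poly"
  assumes const: "\<And>c. P [:[:c:]:]" and X: "P [:[:0, 1:]:]" and Y: "P [:0, 1:]"
    and add: "\<And>p q. P p \<Longrightarrow> P q \<Longrightarrow> P (p + q)"
    and mult: "\<And>p q. P p \<Longrightarrow> P q \<Longrightarrow> P (p * q)"
  shows "P p"
proof (induction p)
  case 0
  show ?case using const[of 0] by simp
next
  case (pCons r p)
  have "P [:r:]"
  proof (induction r)
    case 0
    show ?case using const[of 0] by simp
  next
    case (pCons c r)
    have "[:pCons c r:] = [:[:c:]:] + [:[:0, 1:]:] * [:r:]" by simp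
    thus ?case using add mult const X pCons.IH by metis
  qed
  moreover have "pCons r p = [:r:] + [:0, 1:] * p" by simp
  ultimately show ?case using add mult Y pCons.IH by metis
qed

lemma bipoly_eval_naturality:
  assumes "unital_ring_hom h" "unital_ring_hom g"
  shows "g (bipoly_eval h p a b) = bipoly_eval (\<lambda>c. g (h c)) p (g a) (g b)"
proof -
  interpret h: unital_ring_hom h by fact
  interpret g: unital_ring_hom g by fact
  have gh: "unital_ring_hom (\<lambda>c. g (h c))"
    by standard (simp_all add: h.hom_simps g.hom_simps)
  interpret e: unital_ring_hom "\<lambda>p. bipoly_eval h p a b"
    by (rule bipoly_eval_hom) fact
  interpret e': unital_ring_hom "\<lambda>p. bipoly_eval (\<lambda>c. g (h c)) p (g a) (g b)"
    by (rule bipoly_eval_hom) fact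
  show ?thesis
    by (induction p rule: bipoly_induct)
      (simp_all add: bipoly_eval_generators[OF gh] bipoly_eval_generators[OF assms(1)]
        e.hom_simps e'.hom_simps g.hom_simps)
qed

lemma unital_ring_hom_bipoly_eq:
  assumes "unital_ring_hom g"
  shows "g p = bipoly_eval (\<lambda>c. g [:[:c:]:]) p (g [:[:0, 1:]:]) (g [:0, 1:])"
proof -
  have h: "unital_ring_hom (\<lambda>c::real. [:[:c:]:])"
    by standard (simp_all add: one_pCons)
  interpret e: unital_ring_hom "\<lambda>p. bipoly_eval (\<lambda>c::real. [:[:c:]:]) p [:[:0, 1:]:] [:0, 1:]"
    by (rule bipoly_eval_hom) fact
  have "bipoly_eval (\<lambda>c. [:[:c:]:]) p [:[:0, 1:]:] [:0, 1:] = p"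
    by (induction p rule: bipoly_induct)
      (simp_all only: bipoly_eval_generators[OF h] e.hom_simps)
  thus ?thesis
    using bipoly_eval_naturality[OF h assms, of p "[:[:0, 1:]:]" "[:0, 1:]"] by simp
qed

lemma id_hom: "unital_ring_hom (id :: real \<Rightarrow> real)"
  by standard simp_all

text \<open>Zariski density of the real points of the plane.\<close>

lemma bipoly_zero_if_vanishing:
  assumes "\<And>a b. bipoly_eval id p a b = 0"
  shows "p = 0"
proof (rule poly_eqI)
  fix n
  have "poly (coeff p n) a = 0" for a
  proof -
    have "map_poly (\<lambda>c. poly (map_poly id c) a) p = 0"
      using assms[of a] by (intro iffD1[OF poly_all_0_iff_0]) (simp add: bipoly_eval_def)
    hence "coeff (map_poly (\<lambda>c. poly (map_poly id c) a) p) n = 0" by simp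
    thus ?thesis by (simp add: coeff_map_poly)
  qed
  thus "coeff p n = coeff 0 n" using poly_all_0_iff_0[of "coeff p n"] by simp
qed

section \<open>Evaluation of rational functions at generic points\<close>

locale unital_field_hom = unital_ring_hom h for h :: "'a::field \<Rightarrow> 'b::field"
begin

lemma hom_eq_0_iff: "h x = 0 \<longleftrightarrow> x = 0"
proof
  assume "h x = 0"
  show "x = 0"
  proof (rule ccontr)
    assume "x \<noteq> 0"
    hence "h x * h (inverse x) = 1" by (simp flip: hom_mult add: hom_one)
    thus False using \<open>h x = 0\<close> by simp
  qed
qed (simp add: hom_zero)

lemma hom_divide: "h (x / y) = h x / h y"
proof (cases "y = 0")
  case False
  hence "h (x / y) * h y = h x" by (simp flip: hom_mult)
  thus ?thesis using False by (simp add: field_simps hom_eq_0_iff)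
qed (simp add: hom_zero)

end

text \<open>
  At a point \<open>(a, b)\<close> that is algebraically independent over the scalars every rational function is
  defined, so evaluation is an embedding of fields. The points at which rational functions are
  composed below are of this kind.
\<close>

locale generic_point = unital_ring_hom h for h :: "real \<Rightarrow> 'k::field" +
  fixes a b :: 'k
  assumes nonvanishing: "p \<noteq> 0 \<Longrightarrow> bipoly_eval h p a b \<noteq> 0"
begin

sublocale bipoly: unital_ring_hom "\<lambda>p. bipoly_eval h p a b"
  by (rule bipoly_eval_hom) unfold_locales

lemma defined: "ratfun_defined_at h f a b"
  unfolding ratfun_defined_at_def by (intro nonvanishing) simp

lemma eval_Fract:
  assumes "q \<noteq> 0"
  shows "ratfun_eval h (Fract p q) a b = bipoly_eval h p a b / bipoly_eval h q a b"
proof -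
  define r s where "r = fst (quot_of_fract (Fract p q))" and "s = snd (quot_of_fract (Fract p q))"
  have s: "s \<noteq> 0" by (simp add: s_def)
  have "Fract r s = Fract p q" by (simp add: r_def s_def)
  hence "r * q = p * s" using s assms by (simp add: eq_fract)
  hence "bipoly_eval h r a b * bipoly_eval h q a b = bipoly_eval h p a b * bipoly_eval h s a b"
    by (metis bipoly.hom_mult)
  thus ?thesis using nonvanishing[OF s] nonvanishing[OF assms]
    by (simp add: ratfun_eval_def flip: r_def s_def) (simp add: field_simps)
qed

lemma eval_to_fract: "ratfun_eval h (to_fract p) a b = bipoly_eval h p a b"
  using eval_Fract[of 1 p] by (simp add: to_fract_def bipoly.hom_one)

sublocale eval: unital_field_hom "\<lambda>f. ratfun_eval h f a b"
proof
  fix f g :: ratfun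
  obtain p q where f: "f = Fract p q" "q \<noteq> 0" by (cases f) auto
  obtain r s where g: "g = Fract r s" "s \<noteq> 0" by (cases g) auto
  note nz = nonvanishing[OF f(2)] nonvanishing[OF g(2)]
  show "ratfun_eval h (f + g) a b = ratfun_eval h f a b + ratfun_eval h g a b"
    using nz f(2) g(2) by (simp add: f(1) g(1) eval_Fract bipoly.hom_simps field_simps)
  show "ratfun_eval h (f * g) a b = ratfun_eval h f a b * ratfun_eval h g a b"
    using nz f(2) g(2) by (simp add: f(1) g(1) eval_Fract bipoly.hom_simps field_simps)
next
  show "ratfun_eval h 1 a b = 1"
    using eval_to_fract[of 1] by (simp add: bipoly.hom_one)
qed

lemma eval_const: "ratfun_eval h (ratfun_const c) a b = h c"
  and eval_X: "ratfun_eval h ratfun_X a b = a"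
  and eval_Y: "ratfun_eval h ratfun_Y a b = b"
  unfolding ratfun_const_def ratfun_X_def ratfun_Y_def eval_to_fract
  by (simp_all add: bipoly_eval_generators unital_ring_hom_axioms)

end

lemma ratfun_const_hom: "unital_ring_hom ratfun_const"
  by standard (simp_all add: ratfun_const_def one_pCons flip: to_fract_add to_fract_mult to_fract_1)

lemma bipoly_eval_XY: "bipoly_eval ratfun_const p ratfun_X ratfun_Y = to_fract p"
proof -
  have "unital_ring_hom (to_fract :: real poly poly \<Rightarrow> ratfun)"
    by standard simp_all
  from unital_ring_hom_bipoly_eq[OF this, of p] show ?thesis
    by (simp add: ratfun_const_def[abs_def] ratfun_X_def ratfun_Y_def)
qed

interpretation XY: generic_point ratfun_const ratfun_X ratfun_Y
  using ratfun_const_hom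
  by (auto simp: generic_point_def generic_point_axioms_def bipoly_eval_XY)

lemma ratfun_eval_XY: "ratfun_eval ratfun_const f ratfun_X ratfun_Y = f"
  by (cases f) (metis XY.eval_Fract bipoly_eval_XY Fract_conv_to_fract)

lemma (in unital_field_hom) hom_ratfun_eval:
  assumes "unital_ring_hom k"
  shows "h (ratfun_eval k f a b) = ratfun_eval (\<lambda>c. h (k c)) f (h a) (h b)"
  unfolding ratfun_eval_def
  by (simp add: hom_divide bipoly_eval_naturality[OF assms unital_ring_hom_axioms])

lemma (in unital_field_hom) generic_point_image:
  assumes "generic_point k a b"
  shows "generic_point (\<lambda>c. h (k c)) (h a) (h b)"
proof -
  interpret k: generic_point k a b by fact
  show ?thesis
  proof
    show "bipoly_eval (\<lambda>c. h (k c)) p (h a) (h b) \<noteq> 0" if "p \<noteq> 0" for p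
      using k.nonvanishing[OF that] hom_eq_0_iff
        bipoly_eval_naturality[OF k.unital_ring_hom_axioms unital_ring_hom_axioms, of p a b]
      by metis
  qed (simp_all add: k.hom_simps hom_simps)
qed

text \<open>
  Genericity of a point of the function field is proved by moving the point to Laurent series,
  where a nonzero leading coefficient witnesses that a value is nonzero.
\<close>

lemma (in unital_field_hom) generic_point_reflect:
  assumes "generic_point (\<lambda>c. h (k c)) (h a) (h b)" "unital_ring_hom k"
  shows "generic_point k a b"
proof -
  interpret k: unital_ring_hom k by fact
  interpret hk: generic_point "\<lambda>c. h (k c)" "h a" "h b" by fact
  show ?thesis
  proof
    show "bipoly_eval k p a b \<noteq> 0" if "p \<noteq> 0" for p
      using hk.nonvanishing[OF that] hom_zero
        bipoly_eval_naturality[OF assms(2) unital_ring_hom_axioms, of p a b]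
      by metis
  qed
qed

section \<open>Derivations and the chain rule\<close>

locale derivation =
  fixes d :: "'a::comm_ring_1 \<Rightarrow> 'a"
  assumes d_add: "d (x + y) = d x + d y"
    and d_mult: "d (x * y) = d x * y + x * d y"
begin

lemma d_zero: "d 0 = 0"
  using d_add[of 0 0] by simp

lemma d_one: "d 1 = 0"
  using d_mult[of 1 1] by simp

lemma d_uminus: "d (- x) = - d x"
  using d_add[of x "- x"] d_zero by (simp add: eq_neg_iff_add_eq_0 add.commute)

lemma d_diff: "d (x - y) = d x - d y"
  using d_add[of x "- y"] by (simp add: d_uminus)

lemma d_sum: "d (sum f A) = (\<Sum>i\<in>A. d (f i))"
  by (induction A rule: infinite_finite_induct) (simp_all add: d_zero d_add)

lemmas d_simps = d_add d_mult d_zero d_one d_uminus d_diff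

lemma chain_rule_bipoly:
  assumes h: "unital_ring_hom h" and const: "\<And>c. d (h c) = 0"
  shows "d (bipoly_eval h p a b) =
    bipoly_eval h (map_poly pderiv p) a b * d a + bipoly_eval h (pderiv p) a b * d b"
proof -
  interpret h: unital_ring_hom h by fact
  interpret e: unital_ring_hom "\<lambda>p. bipoly_eval h p a b"
    by (rule bipoly_eval_hom) fact
  have pd: "map_poly pderiv (p + q) = map_poly pderiv p + map_poly pderiv q"
    for p q :: "real poly poly"
    by (rule poly_eqI) (simp add: coeff_map_poly pderiv_add)
  have one: "bipoly_eval h [:1:] a b = 1"
    by (metis e.hom_one one_pCons)
  show ?thesis
    by (induction p rule: bipoly_induct)
      (simp_all add: bipoly_eval_generators[OF h] e.hom_simps h.hom_one one d_simps const pd pderiv_add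
        map_poly_pderiv_mult pderiv_mult map_poly_pCons pderiv_pCons algebra_simps)
qed

end


locale field_derivation = derivation d for d :: "'k::field \<Rightarrow> 'k"
begin

lemma d_divide:
  assumes "y \<noteq> 0"
  shows "d (x / y) = (d x * y - x * d y) / y\<^sup>2"
proof -
  have "d x = d (x / y * y)" using assms by simp
  also have "\<dots> = d (x / y) * y + x / y * d y" by (rule d_mult)
  finally show ?thesis using assms by (simp add: field_simps power2_eq_square)
qed

lemma chain_rule:
  assumes "generic_point h a b" and const: "\<And>c. d (h c) = 0"
  shows "d (ratfun_eval h f a b) = ratfun_eval h (dx f) a b * d a + ratfun_eval h (dy f) a b * d b"
proof -
  interpret generic_point h a b by fact
  obtain p q where f: "f = Fract p q" "q \<noteq> 0" by (cases f) auto
  note nz = nonvanishing[OF f(2)]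
  have q2: "q ^ 2 \<noteq> 0" using f(2) by simp
  show ?thesis
    unfolding f(1) dx_Fract[OF f(2)] dy_Fract[OF f(2)] eval_Fract[OF f(2)] eval_Fract[OF q2]
      d_divide[OF nz] chain_rule_bipoly[OF unital_ring_hom_axioms const]
    using nz by (simp add: bipoly.hom_simps field_simps)
qed

end

lemma fract_deriv_derivation:
  fixes D :: "'a \<Rightarrow> 'a::{idom_divide,ring_gcd,semiring_gcd_mult_normalize}"
  assumes "derivation D"
  shows "field_derivation (fract_deriv D)"
proof
  interpret D: derivation D by fact
  fix f g :: "'a fract"
  obtain p q where f: "f = Fract p q" "q \<noteq> 0" by (cases f) auto
  obtain r s where g: "g = Fract r s" "s \<noteq> 0" by (cases g) auto
  note deriv = fract_deriv_Fract[of D, OF D.d_mult]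
  show "fract_deriv D (f + g) = fract_deriv D f + fract_deriv D g"
    using f(2) g(2)
    by (simp add: f(1) g(1) deriv D.d_simps eq_fract power2_eq_square algebra_simps)
  show "fract_deriv D (f * g) = fract_deriv D f * g + f * fract_deriv D g"
    using f(2) g(2)
    by (simp add: f(1) g(1) deriv D.d_simps eq_fract power2_eq_square algebra_simps)
qed

interpretation dx: field_derivation dx
  unfolding dx_def
  by (intro fract_deriv_derivation derivation.intro map_poly_pderiv_mult poly_eqI)
    (simp add: coeff_map_poly pderiv_add)

interpretation dy: field_derivation dy
  unfolding dy_def
  by (intro fract_deriv_derivation derivation.intro pderiv_add)
     (simp add: pderiv_mult algebra_simps)

lemma dx_generators: "dx (ratfun_const c) = 0" "dx ratfun_X = 1" "dx ratfun_Y = 0"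
  and dy_generators: "dy (ratfun_const c) = 0" "dy ratfun_X = 0" "dy ratfun_Y = 1"
  unfolding ratfun_const_def ratfun_X_def ratfun_Y_def to_fract_def
  by (simp_all add: dx_Fract dy_Fract map_poly_pCons pderiv_pCons One_fract_def Zero_fract_def
      eq_fract pderiv_1 map_poly_1 flip: one_pCons)

text \<open>
  The chain rule at the point \<open>(x, y)\<close>: a derivation over the constants is determined by its
  values at the two coordinates. Applied to a commutator, this gives the symmetry of second
  derivatives below.
\<close>

lemma derivation_ratfun_eq:
  assumes "field_derivation d" "\<And>c. d (ratfun_const c) = 0"
  shows "d f = dx f * d ratfun_X + dy f * d ratfun_Y"
  using field_derivation.chain_rule[OF assms(1) XY.generic_point_axioms assms(2), of f]
  by (simp add: ratfun_eval_XY)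

lemma dx_dy_commute: "dx (dy f) = dy (dx f)"
proof -
  interpret c: field_derivation "\<lambda>f. dx (dy f) - dy (dx f)"
    by standard (simp_all add: dx.d_simps dy.d_simps algebra_simps)
  have "dx (dy f) - dy (dx f) = 0"
    by (subst derivation_ratfun_eq[OF c.field_derivation_axioms])
      (simp_all add: dx_generators dy_generators dx.d_simps dy.d_simps)
  thus ?thesis by simp
qed

section \<open>Leading coefficients of Laurent series\<close>

definition coeffwise :: "('a::comm_ring_1 \<Rightarrow> 'a) \<Rightarrow> 'a fls \<Rightarrow> 'a fls" where
  "coeffwise d F = Abs_fls (\<lambda>n. d (F $$ n))"

lemma fls_eq_shift_fps:
  fixes F :: "'a::zero fls"
  assumes "\<And>k. k < m \<Longrightarrow> F $$ k = 0"
  shows "F = fls_shift (- m) (fps_to_fls (Abs_fps (\<lambda>n. F $$ (int n + m))))"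
  using assms by (intro fls_eqI) simp

context derivation
begin

lemma coeffwise_nth [simp]: "coeffwise d F $$ n = d (F $$ n)"
  unfolding coeffwise_def
  by (rule nth_Abs_fls_lower_bound[of "fls_subdegree F"]) (simp add: d_zero)

lemma coeffwise_derivation: "derivation (coeffwise d)"
proof
  fix F G :: "'a fls"
  show "coeffwise d (F + G) = coeffwise d F + coeffwise d G"
    by (intro fls_eqI) (simp add: d_add)
  obtain m f where F: "F = fls_shift m (fps_to_fls f)"
    using fls_eq_shift_fps[of "fls_subdegree F" F] by auto
  obtain n g where G: "G = fls_shift n (fps_to_fls g)"
    using fls_eq_shift_fps[of "fls_subdegree G" G] by auto
  define D where "D = (\<lambda>f. Abs_fps (\<lambda>n. d (f $ n)))"
  have D: "D (f * g) = D f * g + f * D g"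
    by (intro fps_ext) (simp add: D_def fps_mult_nth d_sum d_mult sum.distrib)
  have shift: "coeffwise d (fls_shift m (fps_to_fls f)) = fls_shift m (fps_to_fls (D f))" for m f
    by (intro fls_eqI) (simp add: D_def d_zero)
  show "coeffwise d (F * G) = coeffwise d F * G + F * coeffwise d G"
    by (simp add: F G fls_times_both_shifted_simp shift D flip: fls_times_fps_to_fls fls_shift_plus)
qed

end

text \<open>
  The coefficient \<open>c\<close> may be 0, so the relation only bounds the order from below. This makes it
  stable under sums, where cancellation is possible.
\<close>

definition leads :: "'a::comm_ring_1 fls \<Rightarrow> int \<Rightarrow> 'a \<Rightarrow> bool" where
  "leads F d c \<longleftrightarrow> (\<forall>k<d. F $$ k = 0) \<and> F $$ d = c"

lemma leads_iff_shift: "leads F d c \<longleftrightarrow> (\<exists>f. F = fls_shift (- d) (fps_to_fls f) \<and> f $ 0 = c)"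
proof
  assume "leads F d c"
  thus "\<exists>f. F = fls_shift (- d) (fps_to_fls f) \<and> f $ 0 = c"
    using fls_eq_shift_fps[of d F] by (intro exI[of _ "Abs_fps (\<lambda>n. F $$ (int n + d))"]) (simp add: leads_def)
qed (auto simp: leads_def)

lemma leads_add: "leads F d c \<Longrightarrow> leads G d e \<Longrightarrow> leads (F + G) d (c + e)"
  by (simp add: leads_def)

lemma leads_diff: "leads F d c \<Longrightarrow> leads G d e \<Longrightarrow> leads (F - G) d (c - e)"
  by (simp add: leads_def)

lemma leads_uminus: "leads F d c \<Longrightarrow> leads (- F) d (- c)"
  by (simp add: leads_def)

lemma leads_mult: "leads F d c \<Longrightarrow> leads G m e \<Longrightarrow> leads (F * G) (d + m) (c * e)"
proof -
  assume "leads F d c" "leads G m e"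
  then obtain f g where "F = fls_shift (- d) (fps_to_fls f)" "f $ 0 = c"
    "G = fls_shift (- m) (fps_to_fls g)" "g $ 0 = e"
    by (auto simp: leads_iff_shift)
  hence "F * G = fls_shift (- (d + m)) (fps_to_fls (f * g))" "(f * g) $ 0 = c * e"
    by (simp_all add: fls_times_both_shifted_simp fls_times_fps_to_fls)
  thus ?thesis unfolding leads_iff_shift by blast
qed

lemma leads_weaken: "leads F d c \<Longrightarrow> k < d \<Longrightarrow> leads F k 0"
  by (simp add: leads_def)

lemma leads_const: "leads (fls_const c) 0 c"
  by (simp add: leads_def)

lemma leads_X: "leads fls_X 1 1"
  by (simp add: leads_def)

lemma leads_zero: "leads 0 d 0"
  by (simp add: leads_def)

lemma leads_power: "leads F d c \<Longrightarrow> leads (F ^ n) (int n * d) (c ^ n)"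
proof (induction n)
  case (Suc n)
  thus ?case using leads_mult[of F d c "F ^ n" "int n * d" "c ^ n"] by (simp add: algebra_simps)
qed (simp add: leads_def)

lemma leads_sum: "(\<And>i. i \<in> A \<Longrightarrow> leads (F i) d (c i)) \<Longrightarrow> leads (\<Sum>i\<in>A. F i) d (\<Sum>i\<in>A. c i)"
  by (induction A rule: infinite_finite_induct) (simp_all add: leads_zero leads_add)

lemma leads_nonzero: "leads F d c \<Longrightarrow> c \<noteq> 0 \<Longrightarrow> F \<noteq> 0"
  by (auto simp: leads_def)

lemma leads_subdegree: "F \<noteq> 0 \<Longrightarrow> leads F (fls_subdegree F) (F $$ fls_subdegree F)"
  by (simp add: leads_def)

lemma leads_divide:
  fixes F :: "'a::field fls"
  assumes "leads F d c" "leads G m e" "e \<noteq> 0"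
  shows "leads (F / G) (d - m) (c / e)"
proof -
  obtain f where f: "F = fls_shift (- d) (fps_to_fls f)" "f $ 0 = c"
    using assms(1) leads_iff_shift by blast
  obtain g where g: "G = fls_shift (- m) (fps_to_fls g)" "g $ 0 = e"
    using assms(2) leads_iff_shift by blast
  have "g * inverse g = 1" using g(2) assms(3) by (simp add: inverse_mult_eq_1')
  hence "F = G * fls_shift (- (d - m)) (fps_to_fls (f * inverse g))"
    by (simp add: f g fls_times_both_shifted_simp flip: fls_times_fps_to_fls) (simp add: ac_simps)
  hence "F / G = fls_shift (- (d - m)) (fps_to_fls (f * inverse g))"
    using leads_nonzero[OF assms(2,3)] by simp
  moreover have "(f * inverse g) $ 0 = c / e"
    by (simp add: f g divide_inverse)
  ultimately show ?thesis unfolding leads_iff_shift by blast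
qed

lemma leads_coeffwise:
  "derivation d \<Longrightarrow> leads F n c \<Longrightarrow> leads (coeffwise d F) n (d c)"
  by (auto simp: leads_def derivation.coeffwise_nth derivation.d_zero)

section \<open>Homogeneous parts and the expansion at the origin\<close>

lemma triple_const_hom: "unital_ring_hom (\<lambda>c::real. [:[:[:c:]:]:])"
  by standard (simp_all add: one_pCons)

text \<open>
  The polynomial \<open>p(sx, sy)\<close> in a new outermost variable \<open>s\<close>, whose coefficients are the homogeneous
  parts of \<open>p\<close>.
\<close>

definition dilated_poly :: "real poly poly \<Rightarrow> real poly poly poly" where
  "dilated_poly p = bipoly_eval (\<lambda>c. [:[:[:c:]:]:]) p [:0, [:[:0, 1:]:]:] [:0, [:0, 1:]:]"

definition homog_part :: "real poly poly \<Rightarrow> nat \<Rightarrow> real poly poly" where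
  "homog_part p n = coeff (dilated_poly p) n"

lemma poly_dilated:
  assumes "unital_ring_hom h"
  shows "poly (map_poly (\<lambda>p. bipoly_eval h p a b) (dilated_poly p)) t = bipoly_eval h p (t * a) (t * b)"
proof -
  interpret h: unital_ring_hom h by fact
  interpret e: unital_ring_hom "\<lambda>p. bipoly_eval h p a b"
    by (rule bipoly_eval_hom) fact
  show ?thesis
    unfolding dilated_poly_def bipoly_eval_naturality[OF triple_const_hom e.poly_map_hom]
    by (simp add: map_poly_pCons e.hom_simps h.hom_simps bipoly_eval_generators[OF assms])
qed

lemma coeff_dilated:
  assumes "unital_ring_hom h"
  shows "coeff (map_poly (\<lambda>p. bipoly_eval h p a b) (dilated_poly p)) n = bipoly_eval h (homog_part p n) a b"
  by (simp add: coeff_map_poly homog_part_def unital_ring_hom.hom_zero[OF bipoly_eval_hom[OF assms]])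

lemma bipoly_eval_homogeneous_expansion:
  assumes "unital_ring_hom h"
  shows "bipoly_eval h p (t * a) (t * b) =
    (\<Sum>n\<le>degree (dilated_poly p). bipoly_eval h (homog_part p n) a b * t ^ n)"
proof -
  define q where "q = map_poly (\<lambda>p. bipoly_eval h p a b) (dilated_poly p)"
  have "degree q \<le> degree (dilated_poly p)"
    unfolding q_def by (rule map_poly_degree_leq)
  hence "poly q t = (\<Sum>n\<le>degree (dilated_poly p). coeff q n * t ^ n)"
    unfolding poly_altdef by (intro sum.mono_neutral_left) (auto simp: coeff_eq_0)
  thus ?thesis
    by (simp add: q_def poly_dilated assms coeff_dilated)
qed

lemma homog_part_eq_0_imp:
  assumes "\<And>n. homog_part p n = 0"
  shows "p = 0"
proof -
  have "bipoly_eval ratfun_const p (1 * ratfun_X) (1 * ratfun_Y) = 0"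
    by (subst bipoly_eval_homogeneous_expansion[OF ratfun_const_hom])
      (simp add: assms XY.bipoly.hom_zero)
  thus ?thesis by (simp add: bipoly_eval_XY)
qed

lemma lowest_homog_part:
  assumes "p \<noteq> 0"
  obtains d where "homog_part p d \<noteq> 0" "\<And>k. k < d \<Longrightarrow> homog_part p k = 0"
proof -
  obtain n where n: "homog_part p n \<noteq> 0" using homog_part_eq_0_imp assms by blast
  have "homog_part p (LEAST n. homog_part p n \<noteq> 0) \<noteq> 0"
    using n by (rule LeastI)
  thus ?thesis
    by (rule that) (use not_less_Least in blast)
qed

definition laurent_const :: "real \<Rightarrow> ratfun fls" where
  "laurent_const c = fls_const (ratfun_const c)"

lemma laurent_const_hom: "unital_ring_hom laurent_const"
  by standard (simp_all add: laurent_const_def XY.hom_simps fls_plus_const)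

lemma leads_bipoly_eval_constant_term:
  assumes "leads U 0 ratfun_X" "leads V 0 ratfun_Y"
  shows "leads (bipoly_eval laurent_const p U V) 0 (to_fract p)"
proof -
  interpret e: unital_ring_hom "\<lambda>p. bipoly_eval laurent_const p U V"
    by (rule bipoly_eval_hom) (rule laurent_const_hom)
  note gen = bipoly_eval_generators[OF laurent_const_hom]
  show ?thesis
  proof (induction p rule: bipoly_induct)
    case (const c)
    show ?case using leads_const[of "ratfun_const c"]
      by (simp add: gen flip: ratfun_const_def laurent_const_def)
  next
    case (mult p q)
    thus ?case using leads_mult by (fastforce simp: e.hom_simps)
  qed (simp_all add: gen e.hom_simps assms leads_add flip: ratfun_X_def ratfun_Y_def)
qed

text \<open>
  The value at \<open>(T U, T V)\<close> is the sum of the terms \<open>p\<^sub>n(U, V) T\<^sup>n\<close> over the homogeneous parts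
  \<open>p\<^sub>n\<close> of \<open>p\<close>, and only the term of lowest degree contributes to the leading coefficient.
\<close>

lemma leads_bipoly_eval:
  assumes U: "leads U 0 ratfun_X" and V: "leads V 0 ratfun_Y" and T: "leads T 1 e"
    and low: "\<And>k. k < d \<Longrightarrow> homog_part p k = 0"
  shows "leads (bipoly_eval laurent_const p (T * U) (T * V)) (int d) (e ^ d * to_fract (homog_part p d))"
proof -
  interpret e: unital_ring_hom "\<lambda>p. bipoly_eval laurent_const p U V"
    by (rule bipoly_eval_hom) (rule laurent_const_hom)
  have "leads (bipoly_eval laurent_const (homog_part p n) U V * T ^ n) (int d)
      (if n = d then e ^ d * to_fract (homog_part p d) else 0)" for n
  proof -
    have lead: "leads (bipoly_eval laurent_const (homog_part p n) U V * T ^ n) (int n)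
        (e ^ n * to_fract (homog_part p n))"
      using leads_mult[OF leads_bipoly_eval_constant_term[OF U V, of "homog_part p n"] leads_power[OF T, of n]]
      by (simp add: mult.commute)
    consider "n < d" | "n = d" | "n > d" by linarith
    thus ?thesis
    proof cases
      case 1
      thus ?thesis by (simp add: low e.hom_zero leads_zero)
    next
      case 3
      thus ?thesis using leads_weaken[OF lead, of d] by simp
    qed (use lead in simp)
  qed
  hence "leads (bipoly_eval laurent_const p (T * U) (T * V)) (int d)
      (\<Sum>n\<le>degree (dilated_poly p). if n = d then e ^ d * to_fract (homog_part p d) else 0)"
    unfolding bipoly_eval_homogeneous_expansion[OF laurent_const_hom] by (intro leads_sum)
  moreover have "homog_part p d = 0" if "\<not> d \<le> degree (dilated_poly p)"
    using that by (simp add: homog_part_def coeff_eq_0)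
  ultimately show ?thesis by (cases "d \<le> degree (dilated_poly p)") simp_all
qed

lemma generic_point_near_origin:
  assumes "leads U 0 ratfun_X" "leads V 0 ratfun_Y" "leads T 1 e" "e \<noteq> 0"
  shows "generic_point laurent_const (T * U) (T * V)"
proof -
  interpret unital_ring_hom laurent_const by (rule laurent_const_hom)
  show ?thesis
  proof
    fix p :: "real poly poly"
    assume "p \<noteq> 0"
    then obtain d where d: "homog_part p d \<noteq> 0" "\<And>k. k < d \<Longrightarrow> homog_part p k = 0"
      using lowest_homog_part by blast
    show "bipoly_eval laurent_const p (T * U) (T * V) \<noteq> 0"
      by (rule leads_nonzero[OF leads_bipoly_eval[OF assms(1-3) d(2)]]) (use d(1) assms(4) in auto)
  qed
qed

text \<open>
  The expansion of \<open>f\<close> at the origin, as the Laurent series of \<open>f(tx, ty)\<close> in \<open>t\<close>. The field of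
  rational functions serves as the field of coefficients, so the coefficient of \<open>t\<^sup>n\<close> is the
  component of \<open>f\<close> of degree \<open>n\<close>.
\<close>

definition dilate :: "ratfun \<Rightarrow> ratfun fls" where
  "dilate f = ratfun_eval laurent_const f (fls_X * fls_const ratfun_X) (fls_X * fls_const ratfun_Y)"

interpretation scaled: generic_point laurent_const "fls_X * fls_const ratfun_X" "fls_X * fls_const ratfun_Y"
  by (rule generic_point_near_origin[OF leads_const leads_const leads_X]) simp

interpretation dilate: unital_field_hom dilate
  unfolding dilate_def[abs_def] ..

lemma dilate_generators:
  "dilate (ratfun_const c) = laurent_const c"
  "dilate ratfun_X = fls_X * fls_const ratfun_X"
  "dilate ratfun_Y = fls_X * fls_const ratfun_Y"
  by (simp_all add: dilate_def scaled.eval_const scaled.eval_X scaled.eval_Y)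

lemma leads_ratfun_eval_nonzero:
  assumes "f \<noteq> 0"
  obtains d c where "c \<noteq> 0"
    "\<And>U V T e. leads U 0 ratfun_X \<Longrightarrow> leads V 0 ratfun_Y \<Longrightarrow> leads T 1 e \<Longrightarrow> e \<noteq> 0 \<Longrightarrow>
      leads (ratfun_eval laurent_const f (T * U) (T * V)) d (e powi d * c)"
proof -
  obtain p q where f: "f = Fract p q" "q \<noteq> 0" by (cases f) auto
  have "p \<noteq> 0" using assms f by (auto simp: Zero_fract_def eq_fract)
  then obtain m where m: "homog_part p m \<noteq> 0" "\<And>k. k < m \<Longrightarrow> homog_part p k = 0"
    using lowest_homog_part by blast
  obtain n where n: "homog_part q n \<noteq> 0" "\<And>k. k < n \<Longrightarrow> homog_part q k = 0"
    using lowest_homog_part[OF f(2)] by blast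
  show ?thesis
  proof (rule that[of "to_fract (homog_part p m) / to_fract (homog_part q n)" "int m - int n"])
    show "to_fract (homog_part p m) / to_fract (homog_part q n) \<noteq> 0" using m n by simp
    fix U V T :: "ratfun fls" and e
    assume l: "leads U 0 ratfun_X" "leads V 0 ratfun_Y" "leads T 1 e" and e: "e \<noteq> 0"
    interpret g: generic_point laurent_const "T * U" "T * V"
      by (rule generic_point_near_origin[OF l e])
    have "leads (ratfun_eval laurent_const f (T * U) (T * V)) (int m - int n)
        ((e ^ m * to_fract (homog_part p m)) / (e ^ n * to_fract (homog_part q n)))"
      unfolding f(1) g.eval_Fract[OF f(2)]
      using m n e by (intro leads_divide leads_bipoly_eval l) auto
    thus "leads (ratfun_eval laurent_const f (T * U) (T * V)) (int m - int n)
        (e powi (int m - int n) * (to_fract (homog_part p m) / to_fract (homog_part q n)))"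
      using e by (simp add: power_int_diff)
  qed
qed

text \<open>
  Substitutions tangent to a dilation \<open>(x, y) \<mapsto> (ex, ey)\<close> rescale the leading form as the dilation
  itself does. If \<open>c = 0\<close> then \<open>d\<close> is not the order of \<open>f\<close>, which is why the version with
  a nonzero leading coefficient comes first.
\<close>

lemma leads_ratfun_eval:
  assumes f: "leads (dilate f) d c"
    and UVT: "leads U 0 ratfun_X" "leads V 0 ratfun_Y" "leads T 1 e" "e \<noteq> 0"
  shows "leads (ratfun_eval laurent_const f (T * U) (T * V)) d (e powi d * c)"
proof (cases "f = 0")
  case True
  interpret g: generic_point laurent_const "T * U" "T * V"
    by (rule generic_point_near_origin[OF UVT])
  show ?thesis using f by (auto simp: True g.eval.hom_zero dilate.hom_zero leads_def)
next
  case False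
  then obtain d' c' where "c' \<noteq> 0"
    and lead: "\<And>U V T e. leads U 0 ratfun_X \<Longrightarrow> leads V 0 ratfun_Y \<Longrightarrow> leads T 1 e \<Longrightarrow> e \<noteq> 0 \<Longrightarrow>
      leads (ratfun_eval laurent_const f (T * U) (T * V)) d' (e powi d' * c')"
    using leads_ratfun_eval_nonzero by metis
  have "leads (dilate f) d' c'"
    using lead[OF leads_const leads_const leads_X] by (simp add: dilate_def)
  hence "d = d' \<and> c = c' \<or> d < d' \<and> c = 0"
    using f \<open>c' \<noteq> 0\<close> unfolding leads_def by (metis linorder_neqE)
  thus ?thesis using lead[OF UVT] leads_weaken by auto
qed

section \<open>Uniqueness for the transport equation\<close>

definition euler :: "ratfun \<Rightarrow> ratfun" where
  "euler f = ratfun_X * dx f + ratfun_Y * dy f"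

interpretation euler: field_derivation euler
  by standard (simp_all add: euler_def dx.d_simps dy.d_simps algebra_simps)

lemma euler_generators: "euler (ratfun_const c) = 0" "euler ratfun_X = ratfun_X" "euler ratfun_Y = ratfun_Y"
  by (simp_all add: euler_def dx_generators dy_generators)

lemma euler_dx: "euler (dx f) = dx (euler f) - dx f"
  by (simp add: euler_def dx.d_simps dx_generators dx_dy_commute)

lemma euler_dy: "euler (dy f) = dy (euler f) - dy f"
  by (simp add: euler_def dy.d_simps dy_generators dx_dy_commute)

interpretation fls_deriv: field_derivation "fls_deriv :: ratfun fls \<Rightarrow> ratfun fls"
  by standard simp_all

text \<open>On expansions at the origin the Euler derivation is \<open>t d/dt\<close>.\<close>

lemma dilate_euler_nth: "dilate (euler f) $$ n = of_int n * dilate f $$ n"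
proof -
  have const: "fls_deriv (laurent_const c) = 0" for c
    by (simp add: laurent_const_def)
  have "fls_X * fls_deriv (dilate f) = dilate (euler f)"
    unfolding dilate_def fls_deriv.chain_rule[OF scaled.generic_point_axioms const] euler_def
      scaled.eval.hom_simps scaled.eval_X scaled.eval_Y
    by (simp add: algebra_simps)
  hence "dilate (euler f) $$ n = (fls_X * fls_deriv (dilate f)) $$ n" by simp
  thus ?thesis by (simp add: fls_X_times_conv_shift)
qed

text \<open>
  Differentiating the coefficients of \<open>f(tx, ty)\<close> and applying the chain rule produces a factor
  \<open>t\<close>, so partial derivatives lower the order by at most one. The lemma is stated for a general
  derivation to cover both partial derivatives at once.
\<close>

lemma leads_dilate_derivation:
  assumes d: "field_derivation d" "\<And>c. d (ratfun_const c) = 0"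
    and f: "leads (dilate f) n c"
  shows "leads (dilate (dx f) * fls_const (d ratfun_X) + dilate (dy f) * fls_const (d ratfun_Y)) (n - 1) (d c)"
proof -
  interpret d: field_derivation d by fact
  interpret cw: field_derivation "coeffwise d"
    using d.coeffwise_derivation by (simp add: field_derivation_def)
  have const: "coeffwise d (laurent_const c) = 0" for c
    by (intro fls_eqI) (simp add: laurent_const_def d(2) d.d_zero)
  have gen: "coeffwise d (fls_X * fls_const z) = fls_X * fls_const (d z)" for z
    by (intro fls_eqI) (simp add: fls_X_times_conv_shift d.d_zero)
  have "coeffwise d (dilate f) = fls_X * (dilate (dx f) * fls_const (d ratfun_X) + dilate (dy f) * fls_const (d ratfun_Y))"
    unfolding dilate_def cw.chain_rule[OF scaled.generic_point_axioms const] gen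
    by (simp add: algebra_simps)
  hence "coeffwise d (dilate f) / fls_X = dilate (dx f) * fls_const (d ratfun_X) + dilate (dy f) * fls_const (d ratfun_Y)"
    by (simp only: nonzero_mult_div_cancel_left[OF fls_X_nonzero])
  thus ?thesis
    using leads_divide[OF leads_coeffwise[OF d.derivation_axioms f] leads_X] by simp
qed

lemma leads_dilate_dx: "leads (dilate f) n c \<Longrightarrow> leads (dilate (dx f)) (n - 1) (dx c)"
  using leads_dilate_derivation[OF dx.field_derivation_axioms dx_generators(1)]
  by (simp add: dx_generators)

lemma leads_dilate_dy: "leads (dilate f) n c \<Longrightarrow> leads (dilate (dy f)) (n - 1) (dy c)"
  using leads_dilate_derivation[OF dy.field_derivation_axioms dy_generators(1)]
  by (simp add: dy_generators)

lemma leads_dilate_field: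
  assumes "leads (dilate P) 2 p" "leads (dilate Q) 2 q" "leads (dilate f) n c"
  shows "leads (dilate (P * dx f + Q * dy f)) (n + 1) (p * dx c + q * dy c)"
  using leads_add[OF leads_mult[OF assms(1) leads_dilate_dx[OF assms(3)]]
      leads_mult[OF assms(2) leads_dilate_dy[OF assms(3)]]]
  by (simp add: dilate.hom_simps algebra_simps)

lemma dilate_of_int: "dilate (of_int k * f) $$ n = of_int k * dilate f $$ n"
proof -
  have nat: "dilate (of_nat m) = of_nat m" for m
    by (induction m) (simp_all add: dilate.hom_simps)
  have "dilate (of_int k) = of_int k"
    by (cases k rule: int_cases2) (simp_all add: nat dilate.hom_uminus)
  hence "dilate (of_int k * f) = fls_const (of_int k) * dilate f"
    by (simp add: dilate.hom_mult fls_of_int)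
  thus ?thesis by simp
qed

text \<open>
  In characteristic 0 an eigenfunction of the Euler derivation has no component outside the degree
  given by the eigenvalue.
\<close>

lemma leads_homogeneous:
  assumes "euler f = of_int k * f"
  shows "leads (dilate f) k (dilate f $$ k)"
proof -
  have "dilate f $$ n = 0" if "n \<noteq> k" for n
    using dilate_euler_nth[of f n] that by (simp add: assms dilate_of_int)
  thus ?thesis by (simp add: leads_def)
qed

text \<open>
  If \<open>n\<close> is the order of \<open>g \<noteq> 0\<close>, then the field \<open>(P, Q)\<close>, being of order at least 2, contributes nothing in
  degree \<open>n\<close>, and comparing coefficients there gives \<open>n = k\<close>.
\<close>

lemma transport_uniqueness:
  assumes P: "leads (dilate P) 2 p" and Q: "leads (dilate Q) 2 q"
    and eq: "euler g - (P * dx g + Q * dy g) = of_int k * g"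
    and g: "leads (dilate g) k 0"
  shows "g = 0"
proof (rule ccontr)
  assume "g \<noteq> 0"
  hence nz: "dilate g \<noteq> 0" by (simp add: dilate.hom_eq_0_iff)
  define n where "n = fls_subdegree (dilate g)"
  have c: "dilate g $$ n \<noteq> 0" using nz by (simp add: n_def)
  have "dilate (P * dx g + Q * dy g) $$ n = 0"
    using leads_dilate_field[OF P Q leads_subdegree[OF nz]] by (simp add: leads_def n_def)
  hence "of_int n * dilate g $$ n = dilate (of_int k * g) $$ n"
    by (simp add: dilate.hom_diff dilate_euler_nth flip: eq)
  hence "of_int n = (of_int k :: ratfun)" using c by (simp add: dilate_of_int)
  hence "n = k" by simp
  thus False using c g by (simp add: leads_def)
qed

lemma homogeneous_uniqueness:
  assumes "euler g = of_int k * g" "leads (dilate g) k 0"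
  shows "g = 0"
  using assms by (intro transport_uniqueness[of 0 0 0 0 g k]) (simp_all add: dilate.hom_zero leads_zero)

lemma generic_point_neg: "generic_point ratfun_const (- ratfun_X) (- ratfun_Y)"
proof -
  have "generic_point (\<lambda>c. dilate (ratfun_const c)) (dilate (- ratfun_X)) (dilate (- ratfun_Y))"
    using generic_point_near_origin[OF leads_const leads_const leads_uminus[OF leads_X]]
    by (simp add: dilate_generators dilate.hom_uminus)
  thus ?thesis
    by (rule dilate.generic_point_reflect) (rule ratfun_const_hom)
qed

interpretation neg: generic_point ratfun_const "- ratfun_X" "- ratfun_Y"
  by (rule generic_point_neg)

text \<open>
  Both sides are homogeneous of degree 2, so it is enough to compare their leading forms, and there
  the sign enters as \<open>(-1)\<^sup>2\<close>.
\<close>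

lemma homogeneous_even:
  assumes "euler f = 2 * f"
  shows "ratfun_eval ratfun_const f (- ratfun_X) (- ratfun_Y) = f"
proof -
  define f' where "f' = ratfun_eval ratfun_const f (- ratfun_X) (- ratfun_Y)"
  have "euler f' = ratfun_eval ratfun_const (euler f) (- ratfun_X) (- ratfun_Y)"
    unfolding f'_def euler.chain_rule[OF generic_point_neg euler_generators(1)] euler.d_uminus euler_generators
    by (simp add: euler_def neg.eval.hom_simps neg.eval_X neg.eval_Y algebra_simps)
  also have "\<dots> = 2 * f'"
    unfolding assms f'_def neg.eval.hom_mult
    using neg.eval.hom_add[of 1 1] by (simp add: neg.eval.hom_one)
  finally have f': "euler f' = 2 * f'" .
  have lead: "leads (dilate f) 2 (dilate f $$ 2)"
    using leads_homogeneous[of f 2] assms by simp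
  have "leads (dilate f') 2 (dilate f $$ 2)"
    unfolding f'_def dilate.hom_ratfun_eval[OF ratfun_const_hom]
    using leads_ratfun_eval[OF lead leads_const leads_const leads_uminus[OF leads_X]]
    by (simp add: dilate_generators dilate.hom_uminus)
  hence "leads (dilate (f' - f)) 2 0"
    using leads_diff lead by (fastforce simp: dilate.hom_diff)
  hence "f' - f = 0"
    using f' assms
    by (intro homogeneous_uniqueness[of "f' - f" 2]) (simp_all add: euler.d_diff algebra_simps)
  thus "ratfun_eval ratfun_const f (- ratfun_X) (- ratfun_Y) = f"
    by (simp add: f'_def)
qed

section \<open>The flow of a quadratic vector field\<close>

text \<open>
  The transport equations are \<open>dF\<^sup>t/dt = (DF\<^sup>t) (P, Q)\<close> for \<open>F\<^sup>t(x, y) = (u(tx, ty), v(tx, ty)) / t\<close>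
  at \<open>t = 1\<close>, and the two conditions on leading forms are \<open>F\<^sup>0 = id\<close>.
\<close>

locale rational_flow =
  fixes u v P Q :: ratfun
  assumes euler_P: "euler P = 2 * P" and euler_Q: "euler Q = 2 * Q"
    and transport_u: "euler u - (P * dx u + Q * dy u) = u"
    and transport_v: "euler v - (P * dx v + Q * dy v) = v"
    and leads_u: "leads (dilate u) 1 ratfun_X"
    and leads_v: "leads (dilate v) 1 ratfun_Y"
begin

definition lie_deriv :: "ratfun \<Rightarrow> ratfun" where
  "lie_deriv f = P * dx f + Q * dy f"

lemma leads_lie_deriv:
  "leads (dilate f) n c \<Longrightarrow>
    leads (dilate (lie_deriv f)) (n + 1) (dilate P $$ 2 * dx c + dilate Q $$ 2 * dy c)"
  unfolding lie_deriv_def using leads_homogeneous[of P 2] leads_homogeneous[of Q 2] euler_P euler_Q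
  by (intro leads_dilate_field) simp_all

sublocale transport: field_derivation "\<lambda>f. euler f - lie_deriv f"
  by standard (simp_all add: lie_deriv_def euler.d_simps dx.d_simps dy.d_simps algebra_simps)

lemma transport_const: "euler (ratfun_const c) - lie_deriv (ratfun_const c) = 0"
  by (simp add: lie_deriv_def euler_generators dx_generators dy_generators)

text \<open>The commutator \<open>[E, W] = W\<close> expresses the homogeneity of the vector field.\<close>

lemma euler_lie_deriv: "euler (lie_deriv f) = lie_deriv (euler f) + lie_deriv f"
  by (simp add: lie_deriv_def euler.d_simps euler_P euler_Q euler_dx euler_dy algebra_simps)

lemma lie_deriv_diff: "lie_deriv (f - g) = lie_deriv f - lie_deriv g"
  by (simp add: lie_deriv_def dx.d_simps dy.d_simps algebra_simps)

text \<open>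
  The series \<open>t\<^sup>-\<^sup>1 u(tx, ty)\<close> and \<open>t\<^sup>-\<^sup>1 v(tx, ty)\<close> are the components of \<open>F\<^sup>t\<close>; with these, the
  points \<open>(u, v)\<close> and \<open>(-u, -v)\<close> take the form required by the lemmas on leading coefficients.
\<close>

lemma scaled_leads:
  "leads (fls_X_inv * dilate u) 0 ratfun_X" "leads (fls_X_inv * dilate v) 0 ratfun_Y"
proof -
  have X: "leads fls_X_inv (- 1) 1" by (simp add: leads_def)
  show "leads (fls_X_inv * dilate u) 0 ratfun_X" "leads (fls_X_inv * dilate v) 0 ratfun_Y"
    using leads_mult[OF X leads_u] leads_mult[OF X leads_v] by simp_all
qed

lemma dilate_uv:
  "dilate u = fls_X * (fls_X_inv * dilate u)" "dilate v = fls_X * (fls_X_inv * dilate v)"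
  by (simp_all add: fls_X_times_conv_shift fls_X_inv_times_conv_shift)

lemma dilate_neg_uv:
  "dilate (- u) = - fls_X * (fls_X_inv * dilate u)" "dilate (- v) = - fls_X * (fls_X_inv * dilate v)"
  using dilate_uv by (simp_all add: dilate.hom_uminus)

lemma generic_point_uv: "generic_point ratfun_const u v"
proof (rule dilate.generic_point_reflect[OF _ ratfun_const_hom])
  show "generic_point (\<lambda>c. dilate (ratfun_const c)) (dilate u) (dilate v)"
    using generic_point_near_origin[OF scaled_leads leads_X]
    unfolding dilate_generators dilate_uv[symmetric] by simp
qed

lemma generic_point_neg_uv: "generic_point ratfun_const (- u) (- v)"
proof (rule dilate.generic_point_reflect[OF _ ratfun_const_hom])
  show "generic_point (\<lambda>c. dilate (ratfun_const c)) (dilate (- u)) (dilate (- v))"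
    unfolding dilate_generators dilate_neg_uv
    by (rule generic_point_near_origin[OF scaled_leads leads_uminus[OF leads_X]]) simp
qed

sublocale uv: generic_point ratfun_const u v
  by (rule generic_point_uv)

sublocale neg_uv: generic_point ratfun_const "- u" "- v"
  by (rule generic_point_neg_uv)

lemma leads_comp:
  assumes f: "leads (dilate f) d c"
  shows "leads (dilate (ratfun_eval ratfun_const f u v)) d c"
    and "leads (dilate (ratfun_eval ratfun_const f (- u) (- v))) d ((- 1) powi d * c)"
proof -
  have "leads (ratfun_eval laurent_const f (dilate u) (dilate v)) d (1 powi d * c)"
    using leads_ratfun_eval[OF f scaled_leads leads_X] unfolding dilate_uv[symmetric] by simp
  thus "leads (dilate (ratfun_eval ratfun_const f u v)) d c"
    by (simp add: dilate.hom_ratfun_eval[OF ratfun_const_hom] dilate_generators)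
  show "leads (dilate (ratfun_eval ratfun_const f (- u) (- v))) d ((- 1) powi d * c)"
    unfolding dilate.hom_ratfun_eval[OF ratfun_const_hom] dilate_generators dilate_neg_uv
    by (rule leads_ratfun_eval[OF f scaled_leads leads_uminus[OF leads_X]]) simp
qed

text \<open>
  Both sides are solutions of \<open>(E - W) g = 2 g\<close>: the left one because \<open>E - W\<close> commutes with \<open>W\<close> up
  to the term \<open>W\<close>, the right one because \<open>E - W\<close> acts on functions of \<open>u\<close> and \<open>v\<close> as \<open>E\<close> acts on
  functions of \<open>x\<close> and \<open>y\<close>. Their components of degree 2 are both that of \<open>M\<close>.
\<close>

lemma lie_deriv_eq_comp:
  assumes w: "euler w - lie_deriv w = w" and lead_w: "leads (dilate w) 1 Z"
    and M: "euler M = 2 * M"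
    and Z: "(Z, M) = (ratfun_X, P) \<or> (Z, M) = (ratfun_Y, Q)"
  shows "lie_deriv w = ratfun_eval ratfun_const M u v"
proof -
  define g where "g = lie_deriv w - ratfun_eval ratfun_const M u v"
  have 1: "euler (lie_deriv w) - lie_deriv (lie_deriv w) = 2 * lie_deriv w"
    using arg_cong[OF w, of lie_deriv] unfolding euler_lie_deriv lie_deriv_diff by (simp add: algebra_simps)
  have 2: "euler (ratfun_eval ratfun_const M u v) - lie_deriv (ratfun_eval ratfun_const M u v)
      = 2 * ratfun_eval ratfun_const M u v"
  proof -
    have "euler (ratfun_eval ratfun_const M u v) - lie_deriv (ratfun_eval ratfun_const M u v)
        = ratfun_eval ratfun_const (euler M) u v"
      unfolding transport.chain_rule[OF uv.generic_point_axioms transport_const]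
      using transport_u transport_v
      by (simp add: euler_def uv.eval.hom_simps uv.eval_X uv.eval_Y lie_deriv_def algebra_simps)
    thus ?thesis using uv.eval.hom_add[of M M] by (simp add: M)
  qed
  have "euler g - (P * dx g + Q * dy g) = 2 * g"
    using 1 2 transport.d_diff[of "lie_deriv w" "ratfun_eval ratfun_const M u v"]
    by (simp add: g_def right_diff_distrib flip: lie_deriv_def)
  moreover have "leads (dilate g) 2 0"
  proof -
    have "leads (dilate M) 2 (dilate M $$ 2)"
      using leads_homogeneous[of M 2] M by simp
    moreover have "dilate M $$ 2 = dilate P $$ 2 * dx Z + dilate Q $$ 2 * dy Z"
      using Z by (auto simp: dx_generators dy_generators)
    ultimately show ?thesis
      using leads_diff[OF leads_lie_deriv[OF lead_w] leads_comp(1)]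
      by (fastforce simp: g_def dilate.hom_diff)
  qed
  ultimately have "g = 0"
    using leads_homogeneous[of P 2] leads_homogeneous[of Q 2] euler_P euler_Q
    by (intro transport_uniqueness[of P _ Q _ g 2]) simp_all
  thus ?thesis by (simp add: g_def)
qed

lemma lie_deriv_u: "lie_deriv u = ratfun_eval ratfun_const P u v"
  by (rule lie_deriv_eq_comp[OF _ leads_u euler_P])
    (simp_all add: lie_deriv_def dx_generators dy_generators transport_u)

lemma lie_deriv_v: "lie_deriv v = ratfun_eval ratfun_const Q u v"
  by (rule lie_deriv_eq_comp[OF _ leads_v euler_Q])
    (simp_all add: lie_deriv_def dx_generators dy_generators transport_v)

lemma even_comp:
  assumes "euler M = 2 * M"
  shows "ratfun_eval ratfun_const M u v = ratfun_eval ratfun_const M (- u) (- v)"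
proof -
  have "ratfun_eval ratfun_const M u v
      = ratfun_eval ratfun_const (ratfun_eval ratfun_const M (- ratfun_X) (- ratfun_Y)) u v"
    by (simp add: homogeneous_even[OF assms])
  also have "\<dots> = ratfun_eval ratfun_const M (- u) (- v)"
    by (simp add: uv.eval.hom_ratfun_eval[OF ratfun_const_hom] uv.eval.hom_uminus
        uv.eval_const uv.eval_X uv.eval_Y)
  finally show ?thesis .
qed

text \<open>
  The point \<open>n = (-u, -v)\<close> satisfies \<open>E n = n - (P, Q)(n)\<close>, by the autonomous equation and the evenness
  of \<open>P\<close> and \<open>Q\<close>. Hence \<open>E (w(n)) = (E w - W w)(n) = w(n)\<close>, so \<open>w(n)\<close> is homogeneous of degree 1
  and equal to its leading form.
\<close>

lemma time_reversal:
  assumes w: "euler w - lie_deriv w = w" and lead_w: "leads (dilate w) 1 Z" and Z: "euler Z = Z"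
    "leads (dilate Z) 1 Z"
  shows "ratfun_eval ratfun_const w (- u) (- v) = - Z"
proof -
  define g where "g = ratfun_eval ratfun_const w (- u) (- v) + Z"
  have eu: "euler (- u) = - u - ratfun_eval ratfun_const P (- u) (- v)"
    using transport_u lie_deriv_u even_comp[OF euler_P]
    by (simp add: euler.d_uminus algebra_simps flip: lie_deriv_def)
  have ev: "euler (- v) = - v - ratfun_eval ratfun_const Q (- u) (- v)"
    using transport_v lie_deriv_v even_comp[OF euler_Q]
    by (simp add: euler.d_uminus algebra_simps flip: lie_deriv_def)
  have "euler (ratfun_eval ratfun_const w (- u) (- v))
      = ratfun_eval ratfun_const (euler w - lie_deriv w) (- u) (- v)"
    unfolding euler.chain_rule[OF neg_uv.generic_point_axioms euler_generators(1)] eu ev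
    by (simp add: euler_def lie_deriv_def neg_uv.eval.hom_simps neg_uv.eval_X neg_uv.eval_Y algebra_simps)
  hence "euler g = g"
    by (simp add: g_def euler.d_add Z w)
  moreover have "leads (dilate g) 1 0"
    using leads_add[OF leads_comp(2)[OF lead_w] Z(2)]
    by (simp add: g_def dilate.hom_add)
  ultimately have "g = 0"
    by (intro homogeneous_uniqueness[of g 1]) simp_all
  thus ?thesis by (simp add: g_def eq_neg_iff_add_eq_0)
qed

lemma birational: "birational_plane u v"
proof -
  have lead_gen: "leads (dilate ratfun_X) 1 ratfun_X" "leads (dilate ratfun_Y) 1 ratfun_Y"
    using leads_mult[OF leads_X leads_const] by (simp_all add: dilate_generators)
  have inv: "ratfun_eval ratfun_const u (- u) (- v) = - ratfun_X"
    "ratfun_eval ratfun_const v (- u) (- v) = - ratfun_Y"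
    using transport_u transport_v leads_u leads_v lead_gen
    by (auto intro!: time_reversal simp: euler_generators simp flip: lie_deriv_def)
  let ?neg = "\<lambda>f. ratfun_eval ratfun_const f (- ratfun_X) (- ratfun_Y)"
  define s t where "s = - ?neg u" and "t = - ?neg v"
  have comp_neg: "ratfun_eval ratfun_const (- ?neg f) u v = - ratfun_eval ratfun_const f (- u) (- v)" for f
    by (simp add: uv.eval.hom_ratfun_eval[OF ratfun_const_hom] uv.eval.hom_uminus
        uv.eval_const uv.eval_X uv.eval_Y)
  have st: "s = ?neg (- u)" "t = ?neg (- v)"
    by (simp_all add: s_def t_def neg.eval.hom_uminus)
  interpret st: generic_point ratfun_const s t
    using neg.eval.generic_point_image[OF neg_uv.generic_point_axioms]
    by (simp add: neg.eval_const st)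
  have comp_st: "ratfun_eval ratfun_const f s t = ?neg (ratfun_eval ratfun_const f (- u) (- v))" for f
    by (simp add: neg.eval.hom_ratfun_eval[OF ratfun_const_hom] neg.eval_const st)
  show ?thesis
    unfolding birational_plane_def ratfun_comp_eq_def
  proof (intro exI conjI)
    show "ratfun_eval ratfun_const u s t = ratfun_X" "ratfun_eval ratfun_const v s t = ratfun_Y"
      by (simp_all add: comp_st inv neg.eval.hom_uminus neg.eval_X neg.eval_Y)
    show "ratfun_eval ratfun_const s u v = ratfun_X" "ratfun_eval ratfun_const t u v = ratfun_Y"
      by (simp_all add: s_def t_def comp_neg inv)
  qed (rule st.defined uv.defined)+
qed

end

section \<open>The boundary condition\<close>

lemma tendsto_poly_div_power_iff:
  fixes A :: "real poly"
  shows "((\<lambda>z. poly A z / z ^ n) \<longlongrightarrow> l) (at 0) \<longleftrightarrow> (\<forall>k<n. coeff A k = 0) \<and> coeff A n = l"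
proof (induction n arbitrary: A)
  case 0
  have "((\<lambda>z. poly A z) \<longlongrightarrow> poly A 0) (at 0)"
    by (intro tendsto_intros)
  thus ?case
    using tendsto_unique[of "at (0::real)" "poly A"] by (auto simp: poly_0_coeff_0)
next
  case (Suc n)
  obtain a B where A: "A = pCons a B" by (cases A)
  show ?case
  proof (cases "a = 0")
    case True
    have "((\<lambda>z. poly A z / z ^ Suc n) \<longlongrightarrow> l) (at 0) \<longleftrightarrow> ((\<lambda>z. poly B z / z ^ n) \<longlongrightarrow> l) (at 0)"
      by (intro tendsto_cong) (auto simp: A True eventually_at_filter)
    moreover have "(\<forall>k<Suc n. coeff A k = 0) \<longleftrightarrow> (\<forall>k<n. coeff B k = 0)"
      by (auto simp: A True coeff_pCons split: nat.split)
    ultimately show ?thesis by (simp add: Suc.IH A)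
  next
    case False
    have "\<not> ((\<lambda>z. poly A z / z ^ Suc n) \<longlongrightarrow> l) (at 0)"
    proof
      assume lim: "((\<lambda>z. poly A z / z ^ Suc n) \<longlongrightarrow> l) (at 0)"
      have "((\<lambda>z. poly A z / z ^ Suc n * z ^ Suc n) \<longlongrightarrow> l * 0 ^ Suc n) (at 0)"
        by (intro tendsto_intros lim)
      moreover have "\<forall>\<^sub>F z in at 0. poly A z / z ^ Suc n * z ^ Suc n = poly A z"
        by (auto simp: eventually_at_filter)
      ultimately have "(poly A \<longlongrightarrow> l * 0 ^ Suc n) (at 0)"
        by (rule Lim_transform_eventually)
      hence "(poly A \<longlongrightarrow> 0) (at 0)" by simp
      moreover have "(poly A \<longlongrightarrow> poly A 0) (at 0)"
        by (intro tendsto_intros)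
      ultimately have "poly A 0 = 0" using tendsto_unique[of "at (0::real)"] by force
      thus False using False by (simp add: A)
    qed
    thus ?thesis using False by (auto simp: A)
  qed
qed

text \<open>
  Along a generic line through the origin the limit determines the lowest coefficients of the
  numerator of \<open>u\<close> in terms of the lowest coefficient of the denominator. These are values of
  homogeneous parts, and by density the relations hold between the homogeneous parts themselves.
\<close>

lemma leads_dilate_of_limit:
  assumes lim: "generically (\<lambda>x y. ((\<lambda>z. ratfun_eval id u (x * z) (y * z) / z) \<longlongrightarrow> bipoly_eval id m x y) (at 0))"
  shows "leads (dilate u) 1 (to_fract m)"
proof -
  interpret e: unital_ring_hom "\<lambda>p. bipoly_eval id p a b" for a b :: real
    by (rule bipoly_eval_hom[OF id_hom])
  obtain g where g: "g \<noteq> 0"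
    and lim: "\<And>a b. bipoly_eval id g a b \<noteq> 0 \<Longrightarrow>
      ((\<lambda>z. ratfun_eval id u (a * z) (b * z) / z) \<longlongrightarrow> bipoly_eval id m a b) (at 0)"
    using lim unfolding generically_def by blast
  define p q where "p = fst (quot_of_fract u)" and "q = snd (quot_of_fract u)"
  have q: "q \<noteq> 0" by (simp add: q_def)
  obtain n where n: "homog_part q n \<noteq> 0" "\<And>k. k < n \<Longrightarrow> homog_part q k = 0"
    using lowest_homog_part[OF q] by blast
  have generic: "(\<forall>k<Suc n. bipoly_eval id (homog_part p k) a b = 0) \<and>
      bipoly_eval id (homog_part p (Suc n)) a b = bipoly_eval id (m * homog_part q n) a b"
    if ab: "bipoly_eval id (g * homog_part q n) a b \<noteq> 0" for a b
  proof -
    define A B where "A = map_poly (\<lambda>r. bipoly_eval id r a b) (dilated_poly p)"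
      and "B = map_poly (\<lambda>r. bipoly_eval id r a b) (dilated_poly q)"
    have u: "ratfun_eval id u (a * z) (b * z) = poly A z / poly B z" for z
      by (simp add: ratfun_eval_def A_def B_def poly_dilated[OF id_hom] mult.commute flip: p_def q_def)
    have coeffs: "coeff A k = bipoly_eval id (homog_part p k) a b" "coeff B k = bipoly_eval id (homog_part q k) a b" for k
      by (simp_all add: A_def B_def coeff_dilated[OF id_hom])
    have B: "((\<lambda>z. poly B z / z ^ n) \<longlongrightarrow> coeff B n) (at 0)"
      unfolding tendsto_poly_div_power_iff by (simp add: coeffs n e.hom_zero)
    have "coeff B n \<noteq> 0" using ab by (auto simp: coeffs e.hom_mult)
    with B have "\<forall>\<^sub>F z in at 0. poly B z / z ^ n \<noteq> 0"
      using tendsto_imp_eventually_ne by blast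
    hence "\<forall>\<^sub>F z in at 0. poly A z / poly B z / z * (poly B z / z ^ n) = poly A z / z ^ Suc n"
      by eventually_elim (auto simp: field_simps)
    moreover have "((\<lambda>z. poly A z / poly B z / z * (poly B z / z ^ n)) \<longlongrightarrow> bipoly_eval id m a b * coeff B n) (at 0)"
      using lim[of a b] ab by (intro tendsto_mult B) (auto simp: u e.hom_mult)
    ultimately have "((\<lambda>z. poly A z / z ^ Suc n) \<longlongrightarrow> bipoly_eval id m a b * coeff B n) (at 0)"
      by (rule Lim_transform_eventually[rotated])
    thus ?thesis unfolding tendsto_poly_div_power_iff by (simp add: coeffs e.hom_mult)
  qed
  \<comment> \<open>Multiplication by \<open>g\<close> and by the lowest part of \<open>q\<close> removes the exceptional points.\<close>
  have density: "r = 0" if "\<And>a b. bipoly_eval id (g * homog_part q n) a b \<noteq> 0 \<Longrightarrow> bipoly_eval id r a b = 0" for r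
  proof -
    have "g * homog_part q n * r = 0"
      by (rule bipoly_zero_if_vanishing) (use that in \<open>auto simp: e.hom_mult\<close>)
    thus ?thesis using g n by simp
  qed
  have low: "homog_part p k = 0" if "k < Suc n" for k
    by (rule density) (use generic that in blast)
  have "homog_part p (Suc n) - m * homog_part q n = 0"
    by (rule density) (use generic in \<open>simp add: e.hom_diff\<close>)
  hence top: "homog_part p (Suc n) = m * homog_part q n" by simp
  have "leads (dilate (Fract p q)) (int (Suc n) - int n)
      ((1 ^ Suc n * to_fract (homog_part p (Suc n))) / (1 ^ n * to_fract (homog_part q n)))"
    unfolding dilate_def scaled.eval_Fract[OF q]
    using n low by (intro leads_divide leads_bipoly_eval leads_const leads_X) auto
  moreover have "Fract p q = u" by (simp add: p_def q_def)
  ultimately show ?thesis using n by (simp add: top)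
qed

section \<open>Birationality\<close>

theorem corollary2:
  fixes u v :: ratfun
  assumes eq_u:
    "(ratfun_X * dx (dx u) + ratfun_Y * dy (dx u)) * (v * dy u - u * dy v)
     + (ratfun_Y * dy (dy u) + ratfun_X * dy (dx u)) * (u * dx v - v * dx u)
     = 2 * (u - ratfun_X * dx u - ratfun_Y * dy u) * (dx u * dy v - dy u * dx v)"
    and eq_v:
    "(ratfun_X * dx (dx v) + ratfun_Y * dy (dx v)) * (v * dy u - u * dy v)
     + (ratfun_Y * dy (dy v) + ratfun_X * dy (dx v)) * (u * dx v - v * dx u)
     = 2 * (v - ratfun_X * dx v - ratfun_Y * dy v) * (dx u * dy v - dy u * dx v)"
    and lim_u:
    "generically (\<lambda>x y. ((\<lambda>z. ratfun_eval id u (x * z) (y * z) / z) \<longlongrightarrow> x) (at 0))"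
    and lim_v:
    "generically (\<lambda>x y. ((\<lambda>z. ratfun_eval id v (x * z) (y * z) / z) \<longlongrightarrow> y) (at 0))"
  shows "birational_plane u v"
proof -
  have leads_u: "leads (dilate u) 1 ratfun_X"
    using leads_dilate_of_limit[of u "[:[:0, 1:]:]"] lim_u
    by (simp add: bipoly_eval_generators[OF id_hom] ratfun_X_def)
  have leads_v: "leads (dilate v) 1 ratfun_Y"
    using leads_dilate_of_limit[of v "[:0, 1:]"] lim_v
    by (simp add: bipoly_eval_generators[OF id_hom] ratfun_Y_def)
  define J where "J = dx u * dy v - dy u * dx v"
  \<comment> \<open>To lowest order \<open>(u, v)\<close> is the identity map, so \<open>J\<close> takes the value 1 at the origin.\<close>
  have "leads (dilate J) 0 1"
    using leads_diff[OF leads_mult[OF leads_dilate_dx[OF leads_u] leads_dilate_dy[OF leads_v]]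
        leads_mult[OF leads_dilate_dy[OF leads_u] leads_dilate_dx[OF leads_v]]]
    by (simp add: J_def dilate.hom_simps dx_generators dy_generators)
  hence J: "J \<noteq> 0"
    using leads_nonzero dilate.hom_zero by fastforce
  \<comment> \<open>By Cramer's rule \<open>(p, q) = (P - x, Q - y)\<close> is the field with \<open>p w\<^sub>x + q w\<^sub>y = - w\<close> for \<open>w\<close> among \<open>u\<close>, \<open>v\<close>.\<close>
  define p q where "p = (v * dy u - u * dy v) / J" and "q = (u * dx v - v * dx u) / J"
  have pJ: "p * J = v * dy u - u * dy v" and qJ: "q * J = u * dx v - v * dx u"
    using J by (simp_all add: p_def q_def)
  have first_order: "p * dx u + q * dy u = - u" "p * dx v + q * dy v = - v"
  proof -
    have "(p * dx u + q * dy u) * J = (p * J) * dx u + (q * J) * dy u"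
      by (simp add: algebra_simps)
    also have "\<dots> = - u * J" unfolding pJ qJ by (simp add: J_def algebra_simps)
    finally show "p * dx u + q * dy u = - u"
      using J mult_right_cancel by blast
    have "(p * dx v + q * dy v) * J = (p * J) * dx v + (q * J) * dy v"
      by (simp add: algebra_simps)
    also have "\<dots> = - v * J" unfolding pJ qJ by (simp add: J_def algebra_simps)
    finally show "p * dx v + q * dy v = - v"
      using J mult_right_cancel by blast
  qed
  have second_order: "p * euler (dx w) + q * euler (dy w) = 2 * (w - euler w)"
    if "(ratfun_X * dx (dx w) + ratfun_Y * dy (dx w)) * (v * dy u - u * dy v)
     + (ratfun_Y * dy (dy w) + ratfun_X * dy (dx w)) * (u * dx v - v * dx u)
     = 2 * (w - ratfun_X * dx w - ratfun_Y * dy w) * (dx u * dy v - dy u * dx v)" for w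
  proof -
    have "(p * euler (dx w) + q * euler (dy w)) * J = euler (dx w) * (p * J) + euler (dy w) * (q * J)"
      by (simp add: algebra_simps)
    also have "\<dots> = 2 * (w - euler w) * J"
      using that unfolding pJ qJ by (simp add: euler_def dx_dy_commute add.commute diff_diff_eq flip: J_def)
    finally show ?thesis using J by simp
  qed
  \<comment> \<open>The defects of homogeneity: \<open>c = E P - 2 P\<close> and \<open>d = E Q - 2 Q\<close>.\<close>
  define c d where "c = euler p - 2 * p - ratfun_X" and "d = euler q - 2 * q - ratfun_Y"
  \<comment> \<open>Apply \<open>E\<close> to the first-order equation and eliminate the second derivatives of \<open>w\<close>.\<close>
  have lin: "c * dx w + d * dy w = 0"
    if "p * dx w + q * dy w = - w" "p * euler (dx w) + q * euler (dy w) = 2 * (w - euler w)" for w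
  proof -
    have "euler p * dx w + p * euler (dx w) + (euler q * dy w + q * euler (dy w)) = - euler w"
      using arg_cong[OF that(1), of euler] by (simp add: euler.d_simps)
    hence "euler p * dx w + euler q * dy w = euler w - 2 * w"
      using that(2) by (simp add: algebra_simps)
    moreover have "2 * w = - 2 * (p * dx w + q * dy w)" using that(1) by simp
    ultimately show ?thesis
      by (simp add: c_def d_def euler_def algebra_simps)
  qed
  have lin_u: "c * dx u + d * dy u = 0" by (rule lin[OF first_order(1) second_order[OF eq_u]])
  have lin_v: "c * dx v + d * dy v = 0" by (rule lin[OF first_order(2) second_order[OF eq_v]])
  have "c * J = dy v * (c * dx u + d * dy u) - dy u * (c * dx v + d * dy v)"
    by (simp add: J_def algebra_simps)
  hence c: "c = 0" using J by (simp add: lin_u lin_v)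
  have "d * J = dx u * (c * dx v + d * dy v) - dx v * (c * dx u + d * dy u)"
    by (simp add: J_def algebra_simps)
  hence d: "d = 0" using J by (simp add: lin_u lin_v)
  have "rational_flow u v (ratfun_X + p) (ratfun_Y + q)"
  proof
    show "euler (ratfun_X + p) = 2 * (ratfun_X + p)" "euler (ratfun_Y + q) = 2 * (ratfun_Y + q)"
      using c d by (simp_all add: c_def d_def euler.d_add euler_generators algebra_simps)
    show "euler u - ((ratfun_X + p) * dx u + (ratfun_Y + q) * dy u) = u"
      "euler v - ((ratfun_X + p) * dx v + (ratfun_Y + q) * dy v) = v"
      using first_order by (simp_all add: euler_def algebra_simps)
  qed (rule leads_u leads_v)+
  thus ?thesis by (rule rational_flow.birational)
qed

end
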